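(* For every finite nonempty alphabet $\Sigma$ and all positive integers $m,n$, there exists an $m$-shift de Bruijn sequence of order $n$ over $\Sigma$.
   Context: $\Sigma^n$ denotes the set of all words of length $n$ over $\Sigma$. For a word $w=a_1a_2\cdots a_\ell$, write $w[i..j]=a_i\cdots a_j$. A word $u$ of length $n$ appears in $w$ (as a factor) at a modulo $m$ position if $u=w[im+1..im+n]$ for some integer $i\ge 0$; distinct values of $i$ count as distinct appearances. An $m$-shift de Bruijn sequence of order $n$ over $\Sigma$ is a word $w$ over $\Sigma$, of length $m|\Sigma|^n+(n-m)$, such that each word in $\Sigma^n$ appears exactly once in $w$ as a factor at a modulo $m$ position. *)

theory Defs
  imports Main
begin

definition words :: "'a set \<Rightarrow> nat \<Rightarrow> 'a list set" where
  "words \<Sigma> n = {u \<in> lists \<Sigma>. length u = n}"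

(* Lists are indexed from 0, so positions i*m+1, ..., i*m+n of a word counted from 1
   are the list indices i*m, ..., i*m+n-1. *)
definition factor_at :: "'a list \<Rightarrow> 'a list \<Rightarrow> nat \<Rightarrow> bool" where
  "factor_at u w p \<longleftrightarrow> p + length u \<le> length w \<and> take (length u) (drop p w) = u"

(* The length is stated over the integers because n - m may be negative. *)
definition shift_de_bruijn :: "nat \<Rightarrow> nat \<Rightarrow> 'a set \<Rightarrow> 'a list \<Rightarrow> bool" where
  "shift_de_bruijn m n \<Sigma> w \<longleftrightarrow>
     w \<in> lists \<Sigma> \<and>
     int (length w) = int m * int (card \<Sigma>) ^ n + (int n - int m) \<and>
     (\<forall>u \<in> words \<Sigma> n. \<exists>!i. factor_at u w (i * m))"

end

theory Submission
  imports Defs "Graph_Theory.Euler"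
begin

text \<open>
  Take the words of length $n - m$ as vertices and let each word $e$ of length $n$ be an arc from
  its prefix of length $n - m$ to the word left after dropping its first $m$ letters. This digraph
  is strongly connected and balanced, so it has a closed Euler trail, and the arcs of the trail
  overlap so that they can be merged into one word in which each starts $m$ letters after the
  previous one. With truncated subtraction the case $n \<le> m$ is uniform: there is a single vertex,
  the empty word, and merging pads each arc to length $m$.
\<close>

lemma words_eq: "words \<Sigma> n = {u. set u \<subseteq> \<Sigma> \<and> length u = n}"
  by (auto simp: words_def lists_eq_set)

lemma words_iff: "u \<in> words \<Sigma> n \<longleftrightarrow> set u \<subseteq> \<Sigma> \<and> length u = n"
  by (simp add: words_eq)

lemma finite_words: "finite \<Sigma> \<Longrightarrow> finite (words \<Sigma> n)"
  unfolding words_eq by (rule finite_lists_length_eq)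

lemma card_words: "finite \<Sigma> \<Longrightarrow> card (words \<Sigma> n) = card \<Sigma> ^ n"
  unfolding words_eq by (rule card_lists_length_eq)

definition shift_graph :: "nat \<Rightarrow> nat \<Rightarrow> 'a set \<Rightarrow> ('a list, 'a list) pre_digraph" where
  "shift_graph m n \<Sigma> =
     \<lparr>verts = words \<Sigma> (n - m), arcs = words \<Sigma> n, tail = take (n - m), head = drop m\<rparr>"

lemma shift_graph_simps [simp]:
  "verts (shift_graph m n \<Sigma>) = words \<Sigma> (n - m)"
  "arcs (shift_graph m n \<Sigma>) = words \<Sigma> n"
  "tail (shift_graph m n \<Sigma>) = take (n - m)"
  "head (shift_graph m n \<Sigma>) = drop m"
  by (simp_all add: shift_graph_def)

lemma fin_digraph_shift_graph:
  assumes "finite \<Sigma>"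
  shows "fin_digraph (shift_graph m n \<Sigma>)"
proof unfold_locales
  fix e assume "e \<in> arcs (shift_graph m n \<Sigma>)"
  then show "tail (shift_graph m n \<Sigma>) e \<in> verts (shift_graph m n \<Sigma>)"
    and "head (shift_graph m n \<Sigma>) e \<in> verts (shift_graph m n \<Sigma>)"
    using set_take_subset[of "n - m" e] set_drop_subset[of m e] by (auto simp: words_iff)
qed (simp_all add: assms finite_words)

text \<open>A word \<open>x\<close> of this length encodes a walk of \<open>j\<close> arcs: its
  windows of length \<open>n\<close> starting at multiples of \<open>m\<close>. The induction splits
  off the first window \<open>take n x\<close> and continues with \<open>drop m x\<close>.\<close>

lemma shift_graph_reachable:
  assumes "finite \<Sigma>" "x \<in> words \<Sigma> (n - m + j * m)"
  shows "take (n - m) x \<rightarrow>\<^sup>*\<^bsub>shift_graph m n \<Sigma>\<^esub> drop (j * m) x"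
  using assms(2)
proof (induction j arbitrary: x)
  case 0
  interpret fin_digraph "shift_graph m n \<Sigma>" using assms(1) by (rule fin_digraph_shift_graph)
  from 0 show ?case by (simp add: words_iff)
next
  case (Suc j)
  interpret fin_digraph "shift_graph m n \<Sigma>" using assms(1) by (rule fin_digraph_shift_graph)
  have "take n x \<in> words \<Sigma> n"
    using Suc.prems set_take_subset[of n x] by (auto simp: words_iff)
  then have "take (n - m) (take n x) \<rightarrow>\<^bsub>shift_graph m n \<Sigma>\<^esub> drop m (take n x)"
    using in_arcs_imp_in_arcs_ends[of "take n x"] by simp
  also have "drop m (take n x) = take (n - m) (drop m x)"
    by (rule drop_take)
  also have "take (n - m) (drop m x) \<rightarrow>\<^sup>*\<^bsub>shift_graph m n \<Sigma>\<^esub> drop (j * m) (drop m x)"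
    using Suc.prems set_drop_subset[of m x] by (intro Suc.IH) (auto simp: words_iff)
  finally show ?case
    by (simp add: min_def add.commute)
qed

lemma connected_shift_graph:
  assumes "finite \<Sigma>" "\<Sigma> \<noteq> {}" "m \<ge> 1"
  shows "connected (shift_graph m n \<Sigma>)"
proof -
  interpret fin_digraph "shift_graph m n \<Sigma>" using assms(1) by (rule fin_digraph_shift_graph)
  obtain a where a: "a \<in> \<Sigma>" using assms(2) by blast
  show ?thesis
  proof (rule connectedI)
    show "verts (shift_graph m n \<Sigma>) \<noteq> {}"
      using a words_iff[of "replicate (n - m) a" \<Sigma> "n - m"] by auto
  next
    fix u v assume uv: "u \<in> verts (shift_graph m n \<Sigma>)" "v \<in> verts (shift_graph m n \<Sigma>)"
    \<comment> \<open>The padding makes the part before \<open>v\<close> exactly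
      \<open>n * m\<close> letters long, so the walk read off \<open>x\<close> leads from
      \<open>u\<close> to \<open>v\<close> in \<open>n\<close> arcs. The number \<open>n\<close> of
      arcs is large enough for \<open>u\<close> to fit into that part.\<close>
    define x where "x = u @ replicate (n * m - (n - m)) a @ v"
    have le: "n - m \<le> n * m" using assms(3) by (cases m) auto
    have "x \<in> words \<Sigma> (n - m + n * m)"
      using uv a le by (auto simp: words_iff x_def)
    from shift_graph_reachable[OF assms(1) this]
    have "u \<rightarrow>\<^sup>*\<^bsub>shift_graph m n \<Sigma>\<^esub> v"
      using uv le by (simp add: x_def words_iff)
    then show "u \<rightarrow>\<^sup>*\<^bsub>with_proj (mk_symmetric (shift_graph m n \<Sigma>))\<^esub> v"
      by (rule reachable_mk_symmetricI)
  qed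
qed

text \<open>Rotation: an arc into \<open>u\<close> ends in \<open>u\<close> after its first
  \<open>m\<close> letters, and moving these letters to the end turns it into an arc out of
  \<open>u\<close>. For \<open>n < m\<close> the rotation is the identity, as every arc is a loop at
  the empty word.\<close>

lemma in_degree_shift_graph:
  assumes "u \<in> words \<Sigma> (n - m)"
  shows "in_degree (shift_graph m n \<Sigma>) u = out_degree (shift_graph m n \<Sigma>) u"
proof -
  have "bij_betw (\<lambda>e. drop m e @ take m e) (in_arcs (shift_graph m n \<Sigma>) u)
          (out_arcs (shift_graph m n \<Sigma>) u)"
  proof (rule bij_betw_byWitness[where f' = "\<lambda>e. drop (n - m) e @ take (n - m) e"])
    show "(\<lambda>e. drop m e @ take m e) ` in_arcs (shift_graph m n \<Sigma>) u
            \<subseteq> out_arcs (shift_graph m n \<Sigma>) u"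
      by (auto simp: words_iff dest!: in_set_takeD in_set_dropD)
    show "(\<lambda>e. drop (n - m) e @ take (n - m) e) ` out_arcs (shift_graph m n \<Sigma>) u
            \<subseteq> in_arcs (shift_graph m n \<Sigma>) u"
      by (cases "m \<le> n") (auto simp: words_iff dest!: in_set_takeD in_set_dropD)
    show "\<forall>e \<in> out_arcs (shift_graph m n \<Sigma>) u. drop m (drop (n - m) e @ take (n - m) e) @
            take m (drop (n - m) e @ take (n - m) e) = e"
      by (cases "m \<le> n") (auto simp: words_iff)
  qed (auto simp: words_iff)
  then show ?thesis
    unfolding in_degree_def out_degree_def by (rule bij_betw_same_card)
qed

lemma cas_shift_graph_successively:
  "pre_digraph.cas (shift_graph m n \<Sigma>) u p v \<Longrightarrow>
     successively (\<lambda>x y. drop m x = take (n - m) y) p"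
proof (induction p arbitrary: u)
  case (Cons e p)
  then show ?case by (cases p) (auto simp: pre_digraph.cas.simps)
qed simp

text \<open>Every word but the last fills a block of exactly \<open>m\<close> letters; its remaining
  letters, if any, are left to its successors. The letter \<open>a\<close> only fills up blocks of
  words shorter than \<open>m\<close>.\<close>

fun merge :: "nat \<Rightarrow> 'a \<Rightarrow> 'a list list \<Rightarrow> 'a list" where
  "merge m a [] = []"
| "merge m a [u] = u"
| "merge m a (u # v # us) = take m (u @ replicate m a) @ merge m a (v # us)"

lemma set_merge: "set (merge m a us) \<subseteq> insert a (\<Union> (set ` set us))"
proof (induction m a us rule: merge.induct)
  case (3 m a u v us)
  have "set (take m (u @ replicate m a)) \<subseteq> insert a (set u)"
    by (auto dest!: in_set_takeD)
  then show ?case using 3 by auto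
qed auto

text \<open>The summand \<open>m\<close> stands on the left because \<open>n - m\<close> would be
  truncated for \<open>n < m\<close>.\<close>

lemma length_merge:
  assumes "us \<noteq> []" "\<forall>u \<in> set us. length u = n"
  shows "length (merge m a us) + m = m * length us + n"
  using assms by (induction m a us rule: merge.induct) simp_all

lemma take_merge:
  assumes "us \<noteq> []" "\<forall>u \<in> set us. length u = n"
    and "successively (\<lambda>x y. drop m x = take (n - m) y) us"
  shows "take n (merge m a us) = hd us"
  using assms
proof (induction m a us rule: merge.induct)
  case (3 m a u v us)
  then have *: "take n (merge m a (v # us)) = v" "length u = n" "drop m u = take (n - m) v" by auto
  \<comment> \<open>The letters of \<open>u\<close> beyond its block are supplied by the overlap
    with \<open>v\<close>, which starts the rest of the merged word by induction.\<close>
  then have "take (n - m) (merge m a (v # us)) = drop m u"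
    by (metis diff_le_self min.absorb1 take_take)
  then show ?case using *(2) by (simp add: min_def)
qed auto

lemma take_drop_merge:
  assumes "i < length us" "\<forall>u \<in> set us. length u = n"
    and "successively (\<lambda>x y. drop m x = take (n - m) y) us"
  shows "take n (drop (i * m) (merge m a us)) = us ! i"
  using assms
proof (induction m a us arbitrary: i rule: merge.induct)
  case (3 m a u v us)
  show ?case
  proof (cases i)
    case 0
    then show ?thesis using take_merge[OF _ "3.prems"(2,3), of a] by simp
  next
    case (Suc j)
    then have "drop (i * m) (merge m a (u # v # us)) =
        drop (j * m) (drop m (merge m a (u # v # us)))"
      by (simp only: drop_drop mult_Suc add.commute[of m])
    \<comment> \<open>Thanks to the padding, the first block has length \<open>m\<close> even if
      \<open>u\<close> is shorter.\<close>
    also have "drop m (merge m a (u # v # us)) = merge m a (v # us)"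
      by simp
    also have "take n (drop (j * m) \<dots>) = (v # us) ! j"
      using "3.prems" Suc by (intro "3.IH") auto
    finally show ?thesis by (simp only: Suc nth_Cons_Suc)
  qed
qed auto

theorem theorem4:
  fixes \<Sigma> :: "'a set" and m n :: nat
  assumes "finite \<Sigma>" and "\<Sigma> \<noteq> {}" and "m \<ge> 1" and "n \<ge> 1"
  shows "\<exists>w. shift_de_bruijn m n \<Sigma> w"
proof -
  interpret fin_digraph "shift_graph m n \<Sigma>" using assms(1) by (rule fin_digraph_shift_graph)
  obtain a where a: "a \<in> \<Sigma>" using assms(2) by blast
  obtain u p where "euler_trail u p u"
    using closed_euler1[OF connected_shift_graph[OF assms(1-3)]] in_degree_shift_graph
    by (metis shift_graph_simps(1))
  then have p: "set p = words \<Sigma> n" "distinct p" "cas u p u"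
    by (auto simp: euler_trail_def trail_def awalk_def)
  note succ = cas_shift_graph_successively[OF p(3)]
  have len: "\<forall>e \<in> set p. length e = n" using p(1) by (simp add: words_iff)
  have length_p: "length p = card \<Sigma> ^ n"
    using p(1,2) by (metis assms(1) card_words distinct_card)
  have "p \<noteq> []" using length_p assms(1,2) by auto
  define w where "w = merge m a p"
  have length_w: "length w + m = m * length p + n"
    unfolding w_def using \<open>p \<noteq> []\<close> len by (rule length_merge)
  \<comment> \<open>The length of \<open>w\<close> leaves room for a factor of length
    \<open>n\<close> at \<open>i * m\<close> exactly when \<open>i < length p\<close>, so the modulo
    \<open>m\<close> positions show the arcs of the trail and nothing else.\<close>
  have factor_at_iff: "factor_at e w (i * m) \<longleftrightarrow> i < length p \<and> p ! i = e"
    if e: "e \<in> words \<Sigma> n" for e i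
  proof -
    have "i * m + n \<le> length w \<longleftrightarrow> Suc i * m \<le> length p * m"
      using length_w by (auto simp: algebra_simps)
    also have "\<dots> \<longleftrightarrow> i < length p" using assms(3) by (simp only: mult_le_cancel2) auto
    finally show ?thesis
      using e take_drop_merge[OF _ len succ, of i a] by (auto simp: factor_at_def words_iff w_def)
  qed
  have "shift_de_bruijn m n \<Sigma> w"
    unfolding shift_de_bruijn_def
  proof (intro conjI ballI)
    show "w \<in> lists \<Sigma>"
    proof -
      have "\<Union> (set ` set p) \<subseteq> \<Sigma>" using p(1) by (auto simp: words_iff)
      with a have "insert a (\<Union> (set ` set p)) \<subseteq> \<Sigma>" by simp
      with set_merge[of m a p] have "set w \<subseteq> \<Sigma>" unfolding w_def by (rule subset_trans)
      then show ?thesis by (simp add: lists_eq_set)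
    qed
    show "int (length w) = int m * int (card \<Sigma>) ^ n + (int n - int m)"
      using arg_cong[OF length_w, of int] by (simp add: length_p)
    fix e assume e: "e \<in> words \<Sigma> n"
    then have "e \<in> set p" using p(1) by simp
    \<comment> \<open>The Euler trail uses each arc exactly once, so \<open>e\<close> has a single
      index in \<open>p\<close>.\<close>
    then show "\<exists>!i. factor_at e w (i * m)"
      unfolding factor_at_iff[OF e] by (rule distinct_Ex1[OF p(2)])
  qed
  then show ?thesis ..
qed

end
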